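(* Let $k$ be a positive integer. For any two distinct faulty nodes $A,B$ of the dense Gaussian network $G_k$, the shifted direct new-source selection algorithm (described in the context), run on input $(k,A,B)$, returns a valid new source, i.e. a node $NS\in G_k$ satisfying $$d(NS,A)=d(NS,B)=k.$$
   Context: Dense Gaussian network: for a positive integer $k$, $G_k$ is the graph whose nodes are the elements of $\mathbb Z[i]/(k+(k+1)i)$, equivalently $\mathbb Z^2$ modulo the lattice generated by $e_1=(k,k+1)$ and $e_2=(-(k+1),k)$, where $(x,y)$ stands for $x+yi$; two nodes are adjacent iff they differ by $\pm1$ or $\pm i$. It has $N=k^2+(k+1)^2$ nodes and diameter $k$. Let $D_k=\{(x,y)\in\mathbb Z^2:|x|+|y|\le k\}$; every node has a unique canonical representative in $D_k$ (the equivalent representative of minimum Manhattan length), and $\operatorname{mod}_{G_k}(\cdot)$ denotes reduction to it. $d$ denotes graph distance in $G_k$; $d(U,V)=|x|+|y|$ where $(x,y)=\operatorname{mod}_{G_k}(U-V)$. Shifted direct new-source selection algorithm. Input: $k$ and $A,B\in G_k$. 1. Set $C=(c,d)=\operatorname{mod}_{G_k}(B-A)\in D_k$. 2. For every $(m,n)\in\{-1,0,1\}^2$: let $(L_x,L_y)=m e_1+n e_2$, $c'=c+L_x$, $d'=d+L_y$. For every sign tuple $(s_1,s_2,s_3,s_4)\in\{\pm1\}^4$: let $M=k+s_3c'+s_4d'$ and $D=s_1s_4-s_2s_3$. (a) If $D\neq0$: let $p=(ks_4-s_2M)/D$ and $q=(s_1M-ks_3)/D$. If $p,q$ are integers, $|p|+|q|=k$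 and $|p-c'|+|q-d'|=k$, put $NS=\operatorname{mod}_{G_k}(A+(p,q))$; if $d(NS,A)=k$ and $d(NS,B)=k$, return $NS$ and stop. (b) If $D=0$ (parallel case): candidates are $(p,q)=(s_1t,\,s_2(k-t))$ with $t$ an integer. If $(s_3,s_4)=(s_1,s_2)$ and $M=k$, the interval is $\max(0,s_1c')\le t\le\min(k,k-s_2d')$. If $(s_3,s_4)=(-s_1,-s_2)$ and $M=-k$, the interval is $\max(0,k-s_2d')\le t\le\min(k,s_1c')$. Otherwise there is no candidate. If the interval is nonempty, take $t$ to be an endpoint of it; if the resulting $(p,q)$ is verified to satisfy the two distance conditions $d((p,q),0)=k$ and $d((p,q),C)=k$, return $NS=\operatorname{mod}_{G_k}(A+(p,q))$ and stop. The loops over $(m,n)$ and over sign tuples may be run in any fixed order. *)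

theory Defs
  imports Main "HOL-Library.Product_Plus"
begin

text \<open>
  The pair \<open>(x, y)\<close> stands for the Gaussian integer \<open>x + y i\<close>. The ideal generated by
  \<open>k + (k+1) i\<close> is spanned over the integers by \<open>e1 k = k + (k+1) i\<close> and \<open>e2 k = i * e1 k\<close>.
\<close>

definition e1 :: "nat \<Rightarrow> int \<times> int" where
  "e1 k = (int k, int k + 1)"

definition e2 :: "nat \<Rightarrow> int \<times> int" where
  "e2 k = (- (int k + 1), int k)"

definition translation :: "nat \<Rightarrow> int \<Rightarrow> int \<Rightarrow> int \<times> int" where
  "translation k m n = (m * fst (e1 k) + n * fst (e2 k), m * snd (e1 k) + n * snd (e2 k))"

definition lattice_rel :: "nat \<Rightarrow> ((int \<times> int) \<times> (int \<times> int)) set" where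
  "lattice_rel k = {(u, v). \<exists>m n. u - v = translation k m n}"

definition node :: "nat \<Rightarrow> int \<times> int \<Rightarrow> (int \<times> int) set" where
  "node k z = lattice_rel k `` {z}"

definition nodes :: "nat \<Rightarrow> (int \<times> int) set set" where
  "nodes k = UNIV // lattice_rel k"

definition adjacent :: "nat \<Rightarrow> ((int \<times> int) set \<times> (int \<times> int) set) set" where
  "adjacent k = {(node k u, node k v) | u v. u - v \<in> {(1, 0), (-1, 0), (0, 1), (0, -1)}}"

text \<open>
  Length of a shortest walk. The graph is connected, since the steps \<open>1\<close> and \<open>i\<close> generate all
  Gaussian integers, so the least number is taken over a nonempty set for all pairs of nodes.
\<close>

definition gdist :: "nat \<Rightarrow> (int \<times> int) set \<Rightarrow> (int \<times> int) set \<Rightarrow> nat" where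
  "gdist k U V = (LEAST n. (U, V) \<in> adjacent k ^^ n)"

definition diamond :: "nat \<Rightarrow> (int \<times> int) set" where
  "diamond k = {(x, y). \<bar>x\<bar> + \<bar>y\<bar> \<le> int k}"

text \<open>Every node contains exactly one element of the diamond, its canonical representative.\<close>

definition rep :: "nat \<Rightarrow> (int \<times> int) set \<Rightarrow> int \<times> int" where
  "rep k U = (THE z. z \<in> U \<and> z \<in> diamond k)"

definition gmod :: "nat \<Rightarrow> int \<times> int \<Rightarrow> int \<times> int" where
  "gmod k z = rep k (node k z)"

text \<open>
  One pass through the body of the loops, for the lattice shift \<open>(m, n)\<close> and the signs
  \<open>(s1, s2, s3, s4)\<close>. The result \<open>None\<close> means that nothing is returned in this pass. The
  parameter \<open>lower\<close> decides which endpoint of the interval is taken in the parallel case.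
  The guards \<open>dvd\<close> say that the two quotients are integers, so that \<open>div\<close> is exact.
\<close>

type_synonym loop_index = "(int \<times> int) \<times> (int \<times> int \<times> int \<times> int)"

definition nonparallel_step ::
  "nat \<Rightarrow> (int \<times> int) set \<Rightarrow> (int \<times> int) set \<Rightarrow> int \<times> int \<Rightarrow>
   int \<times> int \<times> int \<times> int \<Rightarrow> (int \<times> int) set option" where
  "nonparallel_step k A B = (\<lambda>(c', d') (s1, s2, s3, s4).
     let M = int k + s3 * c' + s4 * d';
         D = s1 * s4 - s2 * s3;
         p = (int k * s4 - s2 * M) div D;
         q = (s1 * M - int k * s3) div D;
         NS = node k (gmod k (rep k A + (p, q)))
     in if D dvd (int k * s4 - s2 * M) \<and> D dvd (s1 * M - int k * s3) \<and>
           \<bar>p\<bar> + \<bar>q\<bar> = int k \<and> \<bar>p - c'\<bar> + \<bar>q - d'\<bar> = int k \<and>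
           gdist k NS A = k \<and> gdist k NS B = k
        then Some NS else None)"

definition parallel_interval ::
  "nat \<Rightarrow> int \<times> int \<Rightarrow> int \<times> int \<times> int \<times> int \<Rightarrow> (int \<times> int) option" where
  "parallel_interval k = (\<lambda>(c', d') (s1, s2, s3, s4).
     let M = int k + s3 * c' + s4 * d'
     in if (s3, s4) = (s1, s2) \<and> M = int k
        then Some (max 0 (s1 * c'), min (int k) (int k - s2 * d'))
        else if (s3, s4) = (- s1, - s2) \<and> M = - int k
        then Some (max 0 (int k - s2 * d'), min (int k) (s1 * c'))
        else None)"

definition parallel_step ::
  "nat \<Rightarrow> bool \<Rightarrow> (int \<times> int) set \<Rightarrow> int \<times> int \<Rightarrow> int \<times> int \<Rightarrow>
   int \<times> int \<times> int \<times> int \<Rightarrow> (int \<times> int) set option" where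
  "parallel_step k lower A C = (\<lambda>(c', d') (s1, s2, s3, s4).
     case parallel_interval k (c', d') (s1, s2, s3, s4) of
       None \<Rightarrow> None
     | Some (lo, hi) \<Rightarrow>
         let t = (if lower then lo else hi);
             p = s1 * t;
             q = s2 * (int k - t)
         in if lo \<le> hi \<and>
               gdist k (node k (p, q)) (node k (0, 0)) = k \<and>
               gdist k (node k (p, q)) (node k C) = k
            then Some (node k (gmod k (rep k A + (p, q)))) else None)"

definition loop_body ::
  "nat \<Rightarrow> (loop_index \<Rightarrow> bool) \<Rightarrow> (int \<times> int) set \<Rightarrow> (int \<times> int) set \<Rightarrow>
   loop_index \<Rightarrow> (int \<times> int) set option" where
  "loop_body k lower A B = (\<lambda>((m, n), (s1, s2, s3, s4)).
     let C = gmod k (rep k B - rep k A);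
         C' = C + translation k m n
     in if s1 * s4 - s2 * s3 \<noteq> 0
        then nonparallel_step k A B C' (s1, s2, s3, s4)
        else parallel_step k (lower ((m, n), (s1, s2, s3, s4))) A C C' (s1, s2, s3, s4))"

primrec first_result :: "('a \<Rightarrow> 'b option) \<Rightarrow> 'a list \<Rightarrow> 'b option" where
  "first_result f [] = None"
| "first_result f (x # xs) = (case f x of None \<Rightarrow> first_result f xs | Some r \<Rightarrow> Some r)"

definition loop_indices :: "loop_index set" where
  "loop_indices = ({-1, 0, 1} \<times> {-1, 0, 1}) \<times> ({-1, 1} \<times> {-1, 1} \<times> {-1, 1} \<times> {-1, 1})"

text \<open>
  The order in which the passes are run is given by an enumeration of all combinations of a
  shift and a sign tuple. Nested loops are the enumerations \<open>List.product shifts signs\<close>, and the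
  loops may equally be nested the other way round.
\<close>

definition loop_order :: "loop_index list \<Rightarrow> bool" where
  "loop_order ord \<longleftrightarrow> distinct ord \<and> set ord = loop_indices"

definition new_source ::
  "loop_index list \<Rightarrow> (loop_index \<Rightarrow> bool) \<Rightarrow> nat \<Rightarrow> (int \<times> int) set \<Rightarrow> (int \<times> int) set \<Rightarrow>
   (int \<times> int) set option" where
  "new_source ord lower k A B = first_result (loop_body k lower A B) ord"

end

theory Submission
  imports Defs
begin

text \<open>
  A nonzero lattice vector has Manhattan length at least \<open>2k + 1\<close>. Hence the diamond contains
  exactly one representative of every node, and it realises the graph distance to \<open>0\<close>. What the
  algorithm returns is therefore always valid, and only the success of some pass is at stake.

  The spheres of radius \<open>k\<close> around \<open>0\<close> and \<open>C'\<close> have a common point, lying on two sides that are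
  not parallel, as soon as \<open>C'\<close> has even Manhattan length at most \<open>2k\<close>. If the canonical
  representative \<open>C\<close> of \<open>B - A\<close> has even length, take \<open>C' = C\<close>. If its length \<open>l\<close> is odd, subtract
  the lattice generator that lies in the quadrant of \<open>C\<close>: this gives length \<open>2k + 1 - l\<close>, which is
  even and at most \<open>2k\<close>.
\<close>

section \<open>Manhattan length and the lattice of translations\<close>

definition manhattan :: "int \<times> int \<Rightarrow> int" where
  "manhattan z = \<bar>fst z\<bar> + \<bar>snd z\<bar>"

lemma manhattan_nonneg [simp]: "manhattan z \<ge> 0"
  by (simp add: manhattan_def)

lemma manhattan_triangle: "manhattan (u + v) \<le> manhattan u + manhattan v"
  by (simp add: manhattan_def)

lemma mem_diamond_iff: "z \<in> diamond k \<longleftrightarrow> manhattan z \<le> int k"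
  by (cases z) (simp add: diamond_def manhattan_def)

lemma translation_eq:
  "translation k m n = (m * int k - n * (int k + 1), m * (int k + 1) + n * int k)"
  by (simp add: translation_def e1_def e2_def algebra_simps)

lemma translation_0 [simp]: "translation k 0 0 = 0"
  by (simp add: translation_eq zero_prod_def)

lemma translation_add: "translation k m n + translation k m' n' = translation k (m + m') (n + n')"
  by (simp add: translation_eq algebra_simps)

lemma translation_minus: "- translation k m n = translation k (- m) (- n)"
  by (simp add: translation_eq algebra_simps)

text \<open>The length is the larger of the absolute values of \<open>a + b = m * K - n\<close> and
  \<open>b - a = m + n * K\<close>. In each half-open quadrant of \<open>(m, n)\<close> the two
  terms of one of these do not cancel, so it alone reaches \<open>K\<close>.\<close>

lemma manhattan_translation:
  assumes "(m, n) \<noteq> (0, 0)"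
  shows "manhattan (translation k m n) \<ge> 2 * int k + 1"
proof -
  define K where "K = 2 * int k + 1"
  define a where "a = m * int k - n * (int k + 1)"
  define b where "b = m * (int k + 1) + n * int k"
  have K: "K \<ge> 1" by (simp add: K_def)
  have sum: "a + b = m * K - n" and diff: "b - a = m + n * K"
    by (simp_all add: a_def b_def K_def algebra_simps)
  have pos: "x * K \<ge> K" if "x \<ge> 1" for x
    using mult_right_mono[of 1 x K] that K by simp
  have neg: "x * K \<le> - K" if "x \<le> - 1" for x
    using mult_right_mono[of x "- 1" K] that K by simp
  consider "m \<ge> 1" "n \<le> 0" | "m \<ge> 0" "n \<ge> 1" | "m \<le> - 1" "n \<ge> 0" | "m \<le> 0" "n \<le> - 1"
    using assms by force
  then have "\<bar>a\<bar> + \<bar>b\<bar> \<ge> K"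
    by cases (use pos[of m] pos[of n] neg[of m] neg[of n] sum diff in linarith)+
  then show ?thesis
    by (simp add: manhattan_def translation_eq a_def b_def K_def)
qed

section \<open>Congruence modulo the lattice\<close>

lemma equiv_lattice_rel: "equiv UNIV (lattice_rel k)"
proof (rule equivI)
  show "refl (lattice_rel k)"
    by (auto simp: refl_on_def lattice_rel_def intro!: exI[of _ 0])
  show "sym (lattice_rel k)"
    unfolding sym_def lattice_rel_def by clarify (metis minus_diff_eq translation_minus)
  show "trans (lattice_rel k)"
  proof (rule transI)
    fix u v w assume "(u, v) \<in> lattice_rel k" "(v, w) \<in> lattice_rel k"
    then obtain m n m' n' where "u - v = translation k m n" "v - w = translation k m' n'"
      unfolding lattice_rel_def by blast
    then have "u - w = translation k (m + m') (n + n')"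
      by (metis translation_add diff_add_cancel add_diff_eq)
    then show "(u, w) \<in> lattice_rel k" unfolding lattice_rel_def by blast
  qed
qed simp

lemma node_eq_iff: "node k u = node k v \<longleftrightarrow> (\<exists>m n. u - v = translation k m n)"
  unfolding node_def using eq_equiv_class_iff[OF equiv_lattice_rel, of u v k]
  by (simp add: lattice_rel_def)

lemma node_eq_shift: "node k u = node k v \<Longrightarrow> u - v = u' - v' \<Longrightarrow> node k u' = node k v'"
  by (simp add: node_eq_iff)

lemma node_add_translation [simp]: "node k (z + translation k m n) = node k z"
  by (auto simp: node_eq_iff)

lemma mem_node_iff: "z \<in> node k w \<longleftrightarrow> node k z = node k w"
  unfolding node_def using eq_equiv_class_iff[OF equiv_lattice_rel, of w z k]
  by (auto simp: Image_singleton_iff)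

lemma node_in_nodes [simp]: "node k z \<in> nodes k"
  by (simp add: node_def nodes_def quotientI)

lemma nodesE:
  assumes "U \<in> nodes k"
  obtains u where "U = node k u"
  using assms by (auto simp: nodes_def node_def elim!: quotientE)

section \<open>Canonical representatives\<close>

text \<open>Subtract the vector among \<open>e1\<close>, \<open>e2\<close> and their negatives that
  lies in the quadrant of \<open>z\<close>. Inside the diamond no coordinate of \<open>z\<close>
  exceeds that of the vector in absolute value, so the lengths subtract. Outside, the strict bound
  on one coordinate makes the decrease strict.\<close>

lemma ex_quadrant_shift:
  assumes "z \<noteq> 0"
  shows "\<exists>m \<in> {-1, 0, 1}. \<exists>n \<in> {-1, 0, 1}.
    (manhattan z > int k \<longrightarrow> manhattan (z + translation k m n) < manhattan z) \<and>
    (manhattan z \<le> int k \<longrightarrow> manhattan (z + translation k m n) = 2 * int k + 1 - manhattan z)"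
    (is "\<exists>m \<in> _. \<exists>n \<in> _. ?P m n")
proof -
  obtain x y where z: "z = (x, y)" by (cases z)
  consider "x \<ge> 0" "y \<ge> 1" | "x \<le> - 1" "y \<ge> 0" | "x \<le> 0" "y \<le> - 1" | "x \<ge> 1" "y \<le> 0"
    using assms z by (force simp: zero_prod_def)
  then show ?thesis
  proof cases
    case 1
    then have "?P (- 1) (0)" by (auto simp: z manhattan_def translation_eq)
    then show ?thesis by blast
  next
    case 2
    then have "?P (0) (- 1)" by (auto simp: z manhattan_def translation_eq)
    then show ?thesis by blast
  next
    case 3
    then have "?P (1) (0)" by (auto simp: z manhattan_def translation_eq)
    then show ?thesis by blast
  next
    case 4
    then have "?P (0) (1)" by (auto simp: z manhattan_def translation_eq)
    then show ?thesis by blast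
  qed
qed

lemma ex_diamond_representative: "\<exists>w \<in> diamond k. node k w = node k z"
proof (induction "nat (manhattan z)" arbitrary: z rule: less_induct)
  case less
  show ?case
  proof (cases "manhattan z \<le> int k")
    case True
    then show ?thesis by (auto simp: mem_diamond_iff)
  next
    case False
    then have "z \<noteq> 0" by (auto simp: manhattan_def)
    then obtain m n where "manhattan (z + translation k m n) < manhattan z"
      using False ex_quadrant_shift[of z k] by force
    then have "nat (manhattan (z + translation k m n)) < nat (manhattan z)"
      using manhattan_nonneg[of "z + translation k m n"] by linarith
    from less[OF this] show ?thesis by simp
  qed
qed

text \<open>The difference is a nonzero lattice vector, of length at least \<open>2k + 1\<close>,
  and \<open>w\<close> accounts for at most \<open>k\<close> of it.\<close>

lemma diamond_minimal:
  assumes "node k z = node k w" "w \<in> diamond k" "z \<noteq> w"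
  shows "manhattan z > int k"
proof -
  obtain m n where mn: "z - w = translation k m n" using assms(1) by (auto simp: node_eq_iff)
  with \<open>z \<noteq> w\<close> have "(m, n) \<noteq> (0, 0)" by auto
  then have "2 * int k + 1 \<le> manhattan (z - w)" using manhattan_translation mn by simp
  also have "\<dots> \<le> manhattan z + manhattan w"
    using manhattan_triangle[of z "- w"] by (simp add: manhattan_def)
  finally show ?thesis using assms(2) by (simp add: mem_diamond_iff)
qed

text \<open>Descent gives existence and minimality gives uniqueness, so the definite description in
  \<open>rep\<close> is meaningful.\<close>

lemma rep_node:
  shows rep_in_diamond: "rep k (node k z) \<in> diamond k"
    and node_rep_node: "node k (rep k (node k z)) = node k z"
proof -
  have "\<exists>!w. w \<in> node k z \<and> w \<in> diamond k"
  proof (rule ex_ex1I)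
    show "\<exists>w. w \<in> node k z \<and> w \<in> diamond k"
      using ex_diamond_representative[of k z] by (auto simp: mem_node_iff)
    show "v = w" if "v \<in> node k z \<and> v \<in> diamond k" "w \<in> node k z \<and> w \<in> diamond k" for v w
      using that diamond_minimal[of k v w] by (force simp: mem_node_iff mem_diamond_iff)
  qed
  from theI'[OF this] show "rep k (node k z) \<in> diamond k" "node k (rep k (node k z)) = node k z"
    by (simp_all add: rep_def mem_node_iff)
qed

lemma node_rep: "U \<in> nodes k \<Longrightarrow> node k (rep k U) = U"
  by (metis nodesE node_rep_node)

lemma gmod_in_diamond: "gmod k z \<in> diamond k"
  by (simp add: gmod_def rep_in_diamond)

lemma node_gmod [simp]: "node k (gmod k z) = node k z"
  by (simp add: gmod_def node_rep_node)

section \<open>Graph distance as Manhattan length\<close>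

lemma unit_step: "manhattan z = 1 \<longleftrightarrow> z \<in> {(1, 0), (-1, 0), (0, 1), (0, -1)}"
  by (cases z) (auto simp: manhattan_def)

text \<open>An edge comes with representatives of its own; translating both by the lattice vector
  \<open>u - u'\<close> makes it start at the prescribed \<open>u\<close>.\<close>

lemma adjacent_lift:
  assumes "(node k u, W) \<in> adjacent k"
  obtains w where "W = node k w" "manhattan (u - w) = 1"
proof -
  from assms obtain u' v' where *: "node k u = node k u'" "W = node k v'" "manhattan (u' - v') = 1"
    unfolding adjacent_def unit_step by blast
  show thesis
  proof (rule that)
    show "W = node k (v' + (u - u'))"
      using node_eq_shift[OF *(1)[symmetric], of v' "v' + (u - u')"] *(2) by (simp add: algebra_simps)
    show "manhattan (u - (v' + (u - u'))) = 1" using *(3) by (simp add: algebra_simps)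
  qed
qed

lemma walk_lift:
  assumes "(node k u, V) \<in> adjacent k ^^ n"
  shows "\<exists>v. V = node k v \<and> manhattan (u - v) \<le> int n"
  using assms
proof (induction n arbitrary: V)
  case 0
  then show ?case by (intro exI[of _ u]) (simp add: manhattan_def)
next
  case (Suc n)
  then obtain W where "(node k u, W) \<in> adjacent k ^^ n" and WV: "(W, V) \<in> adjacent k" by auto
  with Suc.IH obtain w where w: "W = node k w" "manhattan (u - w) \<le> int n" by blast
  with WV obtain v where "V = node k v" "manhattan (w - v) = 1" by (metis adjacent_lift)
  then show ?case using w manhattan_triangle[of "u - w" "w - v"] by (intro exI[of _ v]) simp
qed

lemma walk_exists:
  "(node k u, node k v) \<in> adjacent k ^^ nat (manhattan (u - v))"
proof (induction "nat (manhattan (u - v))" arbitrary: v)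
  case 0
  then have "u = v" by (auto simp: manhattan_def prod_eq_iff)
  then show ?case by (simp add: manhattan_def)
next
  case (Suc n)
  obtain x y where xy: "u - v = (x, y)" by (cases "u - v")
  \<comment> \<open>A unit step from \<open>v\<close> towards \<open>u\<close>, along the first axis
    while the first coordinates differ.\<close>
  define s where "s = (if x \<noteq> 0 then (sgn x, 0) else (0, sgn y))"
  have "x \<noteq> 0 \<or> y \<noteq> 0" using Suc.hyps(2) xy by (auto simp: manhattan_def)
  then have s: "manhattan s = 1" "manhattan (u - (v + s)) = manhattan (u - v) - 1"
    by (auto simp: s_def manhattan_def xy sgn_if diff_diff_eq[symmetric])
  with Suc.hyps(2) have n: "n = nat (manhattan (u - (v + s)))" by simp
  have "manhattan ((v + s) - v) = 1" using s(1) by simp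
  then have "(node k (v + s), node k v) \<in> adjacent k" unfolding adjacent_def unit_step by blast
  with Suc.hyps(1)[OF n] n have "(node k u, node k v) \<in> adjacent k ^^ Suc n" by auto
  then show ?case using Suc.hyps(2) by simp
qed

text \<open>A straight walk gives the upper bound. Conversely, a walk lifts to the plane and ends at
  some \<open>v'\<close> congruent to \<open>v\<close>; since \<open>u - v\<close> lies in the
  diamond, \<open>u - v'\<close> cannot be shorter.\<close>

lemma gdist_eq_manhattan:
  assumes "u - v \<in> diamond k"
  shows "gdist k (node k u) (node k v) = nat (manhattan (u - v))"
  unfolding gdist_def
proof (rule Least_equality)
  show "(node k u, node k v) \<in> adjacent k ^^ nat (manhattan (u - v))" by (rule walk_exists)
next
  fix n assume "(node k u, node k v) \<in> adjacent k ^^ n"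
  then obtain v' where v': "node k v' = node k v" "manhattan (u - v') \<le> int n"
    by (metis walk_lift)
  have "node k (u - v') = node k (u - v)"
    using node_eq_shift[OF v'(1)[symmetric]] by simp
  with assms v'(2) show "nat (manhattan (u - v)) \<le> n"
    using diamond_minimal[of k "u - v'" "u - v"] by (force simp: mem_diamond_iff)
qed

lemma gdist_eq_gmod: "gdist k (node k u) (node k v) = nat (manhattan (gmod k (u - v)))"
proof -
  \<comment> \<open>This replaces \<open>u\<close> by the representative of its node in the diamond
    centred at \<open>v\<close>.\<close>
  have "node k (v + gmod k (u - v)) = node k u"
    by (rule node_eq_shift[OF node_gmod[of k "u - v"]]) simp
  then show ?thesis using gdist_eq_manhattan[of "v + gmod k (u - v)" v k] gmod_in_diamond by simp
qed

section \<open>Validity of a returned node\<close>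

lemma node_shifted_difference:
  assumes "A \<in> nodes k" "B \<in> nodes k"
  shows "node k (rep k A + (gmod k (rep k B - rep k A) + translation k m n)) = B"
proof -
  have "node k (rep k A + gmod k (rep k B - rep k A)) = node k (rep k B)"
    by (rule node_eq_shift[OF node_gmod[of k "rep k B - rep k A"]]) simp
  then show ?thesis using assms(2) by (simp add: node_rep add.assoc[symmetric])
qed

text \<open>A nonparallel pass tests both distances to \<open>A\<close> and \<open>B\<close> itself.
  A parallel pass tests them relative to \<open>0\<close> and \<open>C\<close>, and translation by
  \<open>rep k A\<close> carries these to \<open>A\<close> and \<open>B\<close>.\<close>

lemma loop_body_sound:
  assumes "A \<in> nodes k" "B \<in> nodes k" "loop_body k lower A B i = Some NS"
  shows "NS \<in> nodes k \<and> gdist k NS A = k \<and> gdist k NS B = k"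
proof -
  obtain m n s1 s2 s3 s4 where i: "i = ((m, n), (s1, s2, s3, s4))" by (metis prod.exhaust)
  define C where "C = gmod k (rep k B - rep k A)"
  obtain c d where cd: "C + translation k m n = (c, d)" by (cases "C + translation k m n")
  show ?thesis
  proof (cases "s1 * s4 - s2 * s3 = 0")
    case False
    then show ?thesis using assms(3)
      by (auto simp: i loop_body_def C_def[symmetric] cd nonparallel_step_def Let_def
          split: if_splits)
  next
    case True
    then obtain P where P: "gdist k (node k P) (node k (0, 0)) = k" "gdist k (node k P) (node k C) = k"
      and NS: "NS = node k (rep k A + P)"
      using assms(3)
      by (auto simp: i loop_body_def C_def[symmetric] cd parallel_step_def Let_def
          split: option.splits prod.splits if_splits)
    have "gdist k NS (node k (rep k A)) = k"
      using P(1) by (simp add: NS gdist_eq_gmod flip: zero_prod_def)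
    moreover have "gdist k NS (node k (rep k A + C)) = k"
      using P(2) by (simp add: NS gdist_eq_gmod)
    ultimately show ?thesis
      using node_shifted_difference[OF assms(1,2), of 0 0] assms(1) by (simp add: NS node_rep C_def)
  qed
qed

section \<open>Success of some pass\<close>

text \<open>Cramer's rule for the side lines \<open>s1 * p + s2 * q = k\<close> and
  \<open>s3 * p + s4 * q = M\<close>, multiplied out so that each equation yields both divisibility
  and the quotient. Offsets of length exactly \<open>k\<close> lie in the diamond, so the graph
  distances follow.\<close>

lemma nonparallel_step_Some:
  assumes AB: "A \<in> nodes k" "B \<in> nodes k"
    and C': "C' = gmod k (rep k B - rep k A) + translation k m n"
    and D: "s1 * s4 - s2 * s3 = D" "D \<noteq> 0"
    and p: "int k * s4 - s2 * (int k + s3 * fst C' + s4 * snd C') = D * p"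
    and q: "s1 * (int k + s3 * fst C' + s4 * snd C') - int k * s3 = D * q"
    and "manhattan (p, q) = int k" "manhattan ((p, q) - C') = int k"
  shows "nonparallel_step k A B C' (s1, s2, s3, s4) \<noteq> None"
proof -
  let ?NS = "node k (rep k A + (p, q))"
  have "gdist k ?NS (node k (rep k A)) = k"
    using gdist_eq_manhattan[of "rep k A + (p, q)" "rep k A" k] assms(8)
    by (simp add: mem_diamond_iff)
  moreover have "gdist k ?NS (node k (rep k A + C')) = k"
    using gdist_eq_manhattan[of "rep k A + (p, q)" "rep k A + C'" k] assms(9)
    by (simp add: mem_diamond_iff)
  ultimately have "gdist k ?NS A = k" "gdist k ?NS B = k"
    using node_rep[OF AB(1)] node_shifted_difference[OF AB] C' by simp_all
  moreover obtain c d where "C' = (c, d)" by (cases C')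
  ultimately show ?thesis using assms(5-)
    by (simp add: nonparallel_step_def Let_def D(1) manhattan_def)
qed

text \<open>The cases are the axis directions that can dominate \<open>C'\<close>; each fixes one
  side of each sphere. Evenness makes the intersection of the two side lines integral. Dominance and
  the bound \<open>2k\<close> place it on the sides themselves, not on their extensions.\<close>

lemma ex_nonparallel_step:
  assumes AB: "A \<in> nodes k" "B \<in> nodes k"
    and C': "C' = gmod k (rep k B - rep k A) + translation k m n"
    and even: "even (manhattan C')" and le: "manhattan C' \<le> 2 * int k"
  shows "\<exists>s1\<in>{-1, 1}. \<exists>s2\<in>{-1, 1}. \<exists>s3\<in>{-1, 1}. \<exists>s4\<in>{-1, 1}.
    s1 * s4 - s2 * s3 \<noteq> 0 \<and> nonparallel_step k A B C' (s1, s2, s3, s4) \<noteq> None"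
proof -
  obtain c d where cd: "C' = (c, d)" by (cases C')
  have "even (c - d)" using even by (simp add: cd manhattan_def)
  \<comment> \<open>Both \<open>(c - d) / 2 = h\<close> and \<open>(c + d) / 2 = d + h\<close> are
    now integers; the intersection points below are written with them.\<close>
  then obtain h where h: "c = d + 2 * h" by (metis dvdE diff_eq_eq add.commute)
  note step = nonparallel_step_Some[OF AB C']
  note simps = cd manhattan_def h
  consider "c \<ge> \<bar>d\<bar>" | "- c \<ge> \<bar>d\<bar>" | "d \<ge> \<bar>c\<bar>" | "- d \<ge> \<bar>c\<bar>" by linarith
  then show ?thesis
  proof cases
    case 1
    then have "nonparallel_step k A B C' (1, 1, -1, 1) \<noteq> None"
      using le by (intro step[where D = 2 and p = h and q = "int k - h"]) (auto simp: simps)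
    then show ?thesis by force
  next
    case 2
    then have "nonparallel_step k A B C' (-1, 1, 1, 1) \<noteq> None"
      using le by (intro step[where D = "-2" and p = "d + h" and q = "int k + d + h"])
        (auto simp: simps)
    then show ?thesis by force
  next
    case 3
    then have "nonparallel_step k A B C' (1, 1, 1, -1) \<noteq> None"
      using le by (intro step[where D = "-2" and p = "int k + h" and q = "- h"]) (auto simp: simps)
    then show ?thesis by force
  next
    case 4
    then have "nonparallel_step k A B C' (1, -1, 1, 1) \<noteq> None"
      using le by (intro step[where D = 2 and p = "int k + d + h" and q = "d + h"])
        (auto simp: simps)
    then show ?thesis by force
  qed
qed

lemma ex_even_shift:
  assumes "C \<in> diamond k"
  obtains m n where "m \<in> {-1, 0, 1}" "n \<in> {-1, 0, 1}"
    "even (manhattan (C + translation k m n))" "manhattan (C + translation k m n) \<le> 2 * int k"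
proof (cases "even (manhattan C)")
  case True
  then show thesis using assms by (intro that[of 0 0]) (auto simp: mem_diamond_iff)
next
  case False
  then have "manhattan C \<noteq> 0" by (metis even_zero)
  then have "C \<noteq> 0" and pos: "manhattan C \<ge> 1"
    using manhattan_nonneg[of C] by (fastforce simp: manhattan_def, linarith)
  obtain m n where mn: "m \<in> {-1, 0, 1}" "n \<in> {-1, 0, 1}"
    and "manhattan (C + translation k m n) = 2 * int k + 1 - manhattan C"
    using assms ex_quadrant_shift[OF \<open>C \<noteq> 0\<close>, of k] by (force simp: mem_diamond_iff)
  with False pos show thesis by (intro that[OF mn]) auto
qed

lemma ex_loop_body_Some:
  assumes "A \<in> nodes k" "B \<in> nodes k"
  shows "\<exists>i \<in> loop_indices. loop_body k lower A B i \<noteq> None"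
proof -
  obtain m n where mn: "m \<in> {-1, 0, 1}" "n \<in> {-1, 0, 1}"
      "even (manhattan (gmod k (rep k B - rep k A) + translation k m n))"
      "manhattan (gmod k (rep k B - rep k A) + translation k m n) \<le> 2 * int k"
    using ex_even_shift[OF gmod_in_diamond] .
  from ex_nonparallel_step[OF assms refl this(3,4)] obtain s1 s2 s3 s4 :: int
    where s: "s1 \<in> {-1, 1}" "s2 \<in> {-1, 1}" "s3 \<in> {-1, 1}" "s4 \<in> {-1, 1}"
    and "s1 * s4 - s2 * s3 \<noteq> 0"
    and "nonparallel_step k A B (gmod k (rep k B - rep k A) + translation k m n) (s1, s2, s3, s4) \<noteq> None"
    by blast
  then have "loop_body k lower A B ((m, n), (s1, s2, s3, s4)) \<noteq> None"
    by (simp add: loop_body_def Let_def)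
  moreover have "((m, n), (s1, s2, s3, s4)) \<in> loop_indices"
    unfolding loop_indices_def using mn s by (intro SigmaI)
  ultimately show ?thesis by blast
qed

text \<open>An earlier pass may return before the one known to succeed, so only some
  \<open>x\<close> is named; validity must therefore hold for every pass.\<close>

lemma first_result_Some:
  assumes "\<exists>x \<in> set xs. f x \<noteq> None"
  shows "\<exists>x \<in> set xs. \<exists>r. f x = Some r \<and> first_result f xs = Some r"
  using assms by (induction xs) (auto split: option.splits)

theorem theorem2:
  fixes k :: nat
    and A B :: "(int \<times> int) set"
    and ord :: "loop_index list"
    and lower :: "loop_index \<Rightarrow> bool"
  assumes "k > 0"
    and "A \<in> nodes k" and "B \<in> nodes k" and "A \<noteq> B"
    and "loop_order ord"
  shows "\<exists>NS \<in> nodes k. new_source ord lower k A B = Some NS \<and>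
           gdist k NS A = k \<and> gdist k NS B = k"
proof -
  have "\<exists>i \<in> set ord. loop_body k lower A B i \<noteq> None"
    using ex_loop_body_Some assms(2,3,5) by (simp add: loop_order_def)
  from first_result_Some[OF this] obtain i NS
    where "loop_body k lower A B i = Some NS" and "new_source ord lower k A B = Some NS"
    unfolding new_source_def by blast
  with loop_body_sound[OF assms(2,3)] show ?thesis by blast
qed

end
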